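(* Let $E$ and $F$ be two Banach spaces and $L : E \to F$ be a continuous linear mapping. The following two assertions are equivalent. (i) $\operatorname{Im} L$ is closed in $F$. (ii) There exists $c > 0$ such that for every $y \in \operatorname{Im} L$ there exists $x \in E$ with $L(x) = y$ and $\Vert x \Vert \leq c\, \Vert y \Vert$.
   Context: $\operatorname{Im} L = \{L(x) : x \in E\}$ denotes the range of $L$. *)

theory Defs
  imports "HOL-Analysis.Analysis"
begin

end

(* Both implications rest on successive approximation: if every element y of a set can be
   approximated within norm y / 2 by the image of an x with norm x \<le> K * norm y, then the
   corrections sum to an exact preimage of norm at most 2 * K * norm y.  A closed range is complete,
   so by Baire one of the sets closure (L ` cball 0 n) contains a relative ball of the range, and
   taking differences gives such approximations for the range.  Conversely, the bound in (ii)
   gives such approximations for all of closure (range L), which is then contained in range L. *)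
theory Submission
  imports Defs
begin

text \<open>The residuals at least halve in norm at each step, so the corrections are dominated by a
  geometric series and can be summed in the Banach space \<open>'e\<close>. Keeping
  \<open>y - L x\<close> in \<open>S\<close> allows iteration; \<open>S\<close> is abstract to serve
  both \<open>range L\<close> and its closure.\<close>

lemma successive_approximation:
  fixes L :: "'e::banach \<Rightarrow> 'f::real_normed_vector"
  assumes lin: "linear L" and cont: "continuous_on UNIV L"
    and approx: "\<And>y. y \<in> S \<Longrightarrow>
      \<exists>x. norm x \<le> K * norm y \<and> norm (y - L x) \<le> norm y / 2 \<and> y - L x \<in> S"
    and "y \<in> S" and "0 \<le> K"
  shows "\<exists>x. L x = y \<and> norm x \<le> 2 * K * norm y"
proof -
  obtain g where g: "\<And>z. z \<in> S \<Longrightarrow>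
      norm (g z) \<le> K * norm z \<and> norm (z - L (g z)) \<le> norm z / 2 \<and> z - L (g z) \<in> S"
    using approx by metis
  \<comment> \<open>\<open>r n\<close> is what remains of \<open>y\<close> after \<open>n\<close>
    corrections, and \<open>g (r n)\<close> is the next correction.\<close>
  define r where "r n = ((\<lambda>z. z - L (g z)) ^^ n) y" for n
  have r_0: "r 0 = y" and r_Suc: "r (Suc n) = r n - L (g (r n))" for n
    by (simp_all add: r_def)
  have r_S: "r n \<in> S" for n
    by (induction n) (use g \<open>y \<in> S\<close> in \<open>auto simp: r_0 r_Suc\<close>)
  have r_norm: "norm (r n) \<le> (1/2) ^ n * norm y" for n
  proof (induction n)
    case (Suc n)
    then show ?case using g[OF r_S[of n]] by (simp add: r_Suc)
  qed (simp add: r_0)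
  have x_norm: "norm (g (r n)) \<le> K * norm y * (1/2) ^ n" for n
  proof -
    have "norm (g (r n)) \<le> K * norm (r n)" using g[OF r_S] by blast
    also have "\<dots> \<le> K * ((1/2) ^ n * norm y)"
      using r_norm \<open>0 \<le> K\<close> by (rule mult_left_mono)
    finally show ?thesis by (simp add: mult_ac)
  qed
  have geometric: "(\<lambda>n. K * norm y * (1/2) ^ n) sums (K * norm y * 2)"
    using sums_mult[OF geometric_sums[of "1/2::real"], of "K * norm y"] by simp
  have summable_x: "summable (\<lambda>n. g (r n))"
    using x_norm by (intro summable_comparison_test[OF _ sums_summable[OF geometric]]) blast
  have "norm (\<Sum>n. g (r n)) \<le> K * norm y * 2"
    using norm_suminf_le[OF x_norm sums_summable[OF geometric]] sums_unique[OF geometric] by simp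
  moreover have "L (\<Sum>n. g (r n)) = y"
  proof (rule LIMSEQ_unique)
    have "isCont L (\<Sum>n. g (r n))"
      using cont by (simp add: continuous_on_eq_continuous_at)
    then show "(\<lambda>n. L (\<Sum>i<n. g (r i))) \<longlonglongrightarrow> L (\<Sum>n. g (r n))"
      by (rule isCont_tendsto_compose) (rule summable_LIMSEQ[OF summable_x])
    have partial: "L (\<Sum>i<n. g (r i)) = y - r n" for n
      by (induction n) (auto simp: r_0 r_Suc linear_0[OF lin] linear_add[OF lin])
    have "(\<lambda>n. (1/2) ^ n * norm y) \<longlonglongrightarrow> 0"
      by (intro tendsto_mult_left_zero LIMSEQ_power_zero) simp
    then have "r \<longlonglongrightarrow> 0"
      by (rule Lim_null_comparison[OF always_eventually, rotated]) (use r_norm in blast)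
    then have "(\<lambda>n. y - r n) \<longlonglongrightarrow> y - 0" by (intro tendsto_diff tendsto_const)
    then show "(\<lambda>n. L (\<Sum>i<n. g (r i))) \<longlonglongrightarrow> y" by (simp add: partial)
  qed
  ultimately show ?thesis by (auto simp: mult_ac)
qed

text \<open>The relative ball found by Baire's theorem is centred at some \<open>y0\<close>, perhaps
  not at 0. Subtracting approximate preimages of two of its points removes \<open>y0\<close>, and
  scaling then reaches every \<open>y\<close>.\<close>

lemma closed_range_approximation:
  fixes L :: "'e::real_normed_vector \<Rightarrow> 'f::banach"
  assumes lin: "linear L" and "closed (range L)"
  obtains K where "0 < K"
    "\<And>y. y \<in> range L \<Longrightarrow> \<exists>x. norm x \<le> K * norm y \<and> norm (y - L x) \<le> norm y / 2"
proof -
  let ?R = "range L" and ?C = "\<lambda>n::nat. range L \<inter> closure (L ` cball 0 (real n))"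
  \<comment> \<open>Baire is applied to the subspace topology of the range, since the range may have
    empty interior in \<open>'f\<close>.\<close>
  have "\<exists>n. top_of_set ?R interior_of ?C n \<noteq> {}"
  proof (rule ccontr)
    have "completely_metrizable_space (top_of_set ?R)"
      using \<open>closed ?R\<close>
      by (intro completely_metrizable_space_closedin completely_metrizable_space_euclidean) simp
    moreover assume "\<not> ?thesis"
    ultimately have "top_of_set ?R interior_of \<Union>(range ?C) = {}"
      by (intro Baire_category_alt disjI1) (auto intro: closedin_closed_Int)
    moreover have "\<Union>(range ?C) = ?R"
    proof -
      have "L x \<in> closure (L ` cball 0 (real (nat \<lceil>norm x\<rceil>)))" for x
        by (rule subsetD[OF closure_subset]) (auto intro: of_nat_ceiling)
      then show ?thesis by blast
    qed
    ultimately show False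
      using interior_of_topspace[of "top_of_set ?R"] by simp
  qed
  then obtain n y0 where "y0 \<in> top_of_set ?R interior_of ?C n" by blast
  then obtain T where T: "openin (top_of_set ?R) T" "y0 \<in> T" "T \<subseteq> ?C n"
    by (auto simp: interior_of_def)
  then obtain e where "e > 0" "ball y0 e \<inter> ?R \<subseteq> T"
    by (auto simp: openin_contains_ball)
  with T have e: "ball y0 e \<inter> ?R \<subseteq> ?C n" and "y0 \<in> ?R" by auto
  \<comment> \<open>Two errors below \<open>e/8\<close> add up to at most \<open>e/4\<close>, half
    the length \<open>e/2\<close> of the rescaled vector used below.\<close>
  have approx: "\<exists>a. norm a \<le> n \<and> norm (L a - z) < e/8" if "z \<in> ?R" "dist y0 z < e" for z
  proof -
    have "z \<in> closure (L ` cball 0 (real n))" using e that by auto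
    then have "\<exists>w\<in>L ` cball 0 (real n). dist w z < e/8"
      by (rule closure_approachable[THEN iffD1, rule_format]) (use \<open>e > 0\<close> in simp)
    then obtain a where "a \<in> cball 0 (real n)" "dist (L a) z < e/8"
      by blast
    then show ?thesis by (auto simp: dist_norm)
  qed
  show thesis
  proof
    \<comment> \<open>The constant is the bound \<open>2 * Suc n\<close> for the difference of two
      preimages times the scale \<open>2 / e\<close>; \<open>Suc n\<close> keeps it positive when
      \<open>n = 0\<close>.\<close>
    show "0 < 4 * real (Suc n) / e" using \<open>e > 0\<close> by simp
    fix y assume "y \<in> ?R"
    show "\<exists>x. norm x \<le> 4 * real (Suc n) / e * norm y \<and> norm (y - L x) \<le> norm y / 2"
    proof (cases "y = 0")
      case True
      then show ?thesis by (intro exI[of _ 0]) (simp add: linear_0[OF lin])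
    next
      case False
      \<comment> \<open>Dividing by \<open>t\<close> gives \<open>y\<close> length
        \<open>e/2\<close>, so \<open>y0 + y /\<^sub>R t\<close> lies in the ball around
        \<open>y0\<close>.\<close>
      define t where "t = 2 * norm y / e"
      have "t > 0" using False \<open>e > 0\<close> by (simp add: t_def)
      have "norm (y /\<^sub>R t) = e/2"
        using \<open>e > 0\<close> False by (simp add: t_def field_simps)
      moreover have "y0 + y /\<^sub>R t \<in> ?R"
        using \<open>y0 \<in> ?R\<close> \<open>y \<in> ?R\<close> linear_subspace_image[OF lin subspace_UNIV]
        by (blast intro: subspace_add subspace_scale)
      ultimately obtain a where a: "norm a \<le> n" "norm (L a - (y0 + y /\<^sub>R t)) < e/8"
        using approx[of "y0 + y /\<^sub>R t"] \<open>e > 0\<close> by (auto simp: dist_norm)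
      obtain b where b: "norm b \<le> n" "norm (L b - y0) < e/8"
        using approx[OF \<open>y0 \<in> ?R\<close>] \<open>e > 0\<close> by auto
      have "norm (y /\<^sub>R t - L (a - b)) = norm ((L b - y0) - (L a - (y0 + y /\<^sub>R t)))"
        by (simp add: linear_diff[OF lin] algebra_simps)
      also have "\<dots> \<le> e/4"
        using norm_triangle_ineq4[of "L b - y0" "L a - (y0 + y /\<^sub>R t)"] a(2) b(2) by linarith
      finally have "t * norm (y /\<^sub>R t - L (a - b)) \<le> t * (e/4)"
        using \<open>t > 0\<close> by simp
      moreover have "t * norm (y /\<^sub>R t - L (a - b)) = norm (y - L (t *\<^sub>R (a - b)))"
      proof -
        have "y - L (t *\<^sub>R (a - b)) = t *\<^sub>R (y /\<^sub>R t - L (a - b))"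
          using \<open>t > 0\<close> by (simp add: linear_scale[OF lin] linear_diff[OF lin] scaleR_diff_right)
        then show ?thesis using \<open>t > 0\<close> by simp
      qed
      ultimately have "norm (y - L (t *\<^sub>R (a - b))) \<le> norm y / 2"
        using \<open>e > 0\<close> by (simp add: t_def)
      moreover have "norm (t *\<^sub>R (a - b)) \<le> 4 * real (Suc n) / e * norm y"
      proof -
        have "norm (a - b) \<le> 2 * real (Suc n)"
          using norm_triangle_ineq4[of a b] a b by simp
        then have "t * norm (a - b) \<le> t * (2 * real (Suc n))"
          using \<open>t > 0\<close> by simp
        then show ?thesis using \<open>e > 0\<close> by (simp add: t_def mult_ac)
      qed
      ultimately show ?thesis by blast
    qed
  qed
qed

theorem theorem2p1:
  fixes L :: "'e::banach \<Rightarrow> 'f::banach"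
  assumes "linear L" and "continuous_on UNIV L"
  shows "closed (range L) \<longleftrightarrow>
    (\<exists>c>0. \<forall>y\<in>range L. \<exists>x. L x = y \<and> norm x \<le> c * norm y)"
proof
  have subspace: "subspace (range L)"
    using \<open>linear L\<close> subspace_UNIV by (rule linear_subspace_image)
  {
    assume "closed (range L)"
    then obtain K where K: "0 < K"
      "\<And>y. y \<in> range L \<Longrightarrow> \<exists>x. norm x \<le> K * norm y \<and> norm (y - L x) \<le> norm y / 2"
      using closed_range_approximation[OF \<open>linear L\<close>] by blast
    have "\<exists>x. L x = y \<and> norm x \<le> 2 * K * norm y" if "y \<in> range L" for y
    proof (rule successive_approximation[OF assms _ that])
      show "\<exists>x. norm x \<le> K * norm z \<and> norm (z - L x) \<le> norm z / 2 \<and> z - L x \<in> range L"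
        if "z \<in> range L" for z
        using K(2)[OF that] subspace_diff[OF subspace that] by blast
    qed (use K in simp)
    with \<open>0 < K\<close> show "\<exists>c>0. \<forall>y\<in>range L. \<exists>x. L x = y \<and> norm x \<le> c * norm y"
      by (intro exI[of _ "2 * K"]) simp
  }
  assume "\<exists>c>0. \<forall>y\<in>range L. \<exists>x. L x = y \<and> norm x \<le> c * norm y"
  then obtain c where "c > 0"
    and c: "\<And>y. y \<in> range L \<Longrightarrow> \<exists>x. L x = y \<and> norm x \<le> c * norm y" by blast
  have "y \<in> range L" if "y \<in> closure (range L)" for y
  proof -
    have "\<exists>x. L x = y \<and> norm x \<le> 2 * (2 * c) * norm y"
    proof (rule successive_approximation[OF assms _ that])
      fix z assume z: "z \<in> closure (range L)"
      \<comment> \<open>For \<open>z = 0\<close> the tolerance \<open>norm z / 2\<close> is not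
        positive, so \<open>w = 0\<close> is taken directly.\<close>
      obtain w where w: "w \<in> range L" "norm (z - w) \<le> norm z / 2"
      proof (cases "z = 0")
        case True
        then show thesis using that subspace_0[OF subspace] by simp
      next
        case False
        then obtain w where "w \<in> range L" "dist w z < norm z / 2"
          using closure_approachable[THEN iffD1, OF z, rule_format, of "norm z / 2"] by auto
        then show thesis using that[of w] by (simp add: dist_norm norm_minus_commute)
      qed
      then obtain x where x: "L x = w" "norm x \<le> c * norm w" using c by blast
      \<comment> \<open>The triangle inequality gives the factor 3/2, rounded up to 2; hence the
        approximation constant \<open>2 * c\<close>.\<close>
      have "norm w \<le> 2 * norm z"
        using w(2) norm_triangle_ineq3[of w z] norm_ge_zero[of z]
        by (simp add: norm_minus_commute del: norm_ge_zero)
      then have "c * norm w \<le> c * (2 * norm z)" using \<open>c > 0\<close> by simp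
      \<comment> \<open>Translating by \<open>w\<close>, an element of the subspace
        \<open>range L\<close>, preserves its closure.\<close>
      moreover have "z - w \<in> closure (range L)"
        unfolding closure_approachable
      proof (intro allI impI)
        fix d :: real assume "d > 0"
        then obtain v where v: "v \<in> range L" "dist v z < d"
          using z unfolding closure_approachable by blast
        then show "\<exists>u\<in>range L. dist u (z - w) < d"
          using subspace_diff[OF subspace v(1) w(1)] by (intro bexI[of _ "v - w"]) (auto simp: dist_norm)
      qed
      ultimately show "\<exists>x. norm x \<le> 2 * c * norm z \<and> norm (z - L x) \<le> norm z / 2
          \<and> z - L x \<in> closure (range L)"
        using x w by (intro exI[of _ x]) simp
    qed (use \<open>c > 0\<close> in simp)
    then show ?thesis by blast
  qed
  then show "closed (range L)" using closure_subset_eq by blast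
qed

end
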